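(* Up to isomorphism, the class $BIR_{2,2}$ of all groups generated by a 2-state bi-reversible automaton over the sequence of binary alphabets consists of exactly five groups: the trivial group $\{id\}$, the cyclic group of order two $\mathbb{Z}_2$, the Klein group $\mathbb{Z}_2\times\mathbb{Z}_2$, the cyclic group of order four $\mathbb{Z}_4$ and the direct product $\mathbb{Z}_2\times\mathbb{Z}_4$. Only the first three groups ($\{id\}$, $\mathbb{Z}_2$, $\mathbb{Z}_2\times\mathbb{Z}_2$) belong to the subclass $BIRM_{2,2}\subseteq BIR_{2,2}$ of groups generated by a 2-state bi-reversible Mealy automaton over the binary alphabet.
   Context: The sequence of binary alphabets is $X=(X_i)_{i\geq 1}$ with $X_i=\{0,1\}$ for every $i\ge 1$, and $X^*$ is the set of all finite words over $\{0,1\}$ (including the empty word $\epsilon$). An automaton $A=(X,Q,\varphi,\psi)$ over $X$ consists of a finite set $Q$ (states), a sequence $\varphi=(\varphi_i)_{i\ge1}$ of transition functions $\varphi_i\colon Q\times X_i\to Q$ and a sequence $\psi=(\psi_i)_{i\ge1}$ of output functions $\psi_i\colon Q\times X_i\to X_i$ (these may vary with $i$); it is 2-state if $|Q|=2$. If the sequences $\varphi$ and $\psi$ are constant, $A$ is a Mealy automaton over the binary alphabet. $A$ is invertible if for all $i\ge 1$, $q\in Q$ the map $\sigma_{i,q}\colon x\mapsto\psi_i(q,x)$ is a permutation of $X_i$; then the inverse automaton is $A^{-1}=(X,Q,\varphi',\psi')$ with $\varphi'_i(q,x)=\varphi_i(q,\sigma_{i,q}^{-1}(x))$, $\psi'_i(q,x)=\sigma_{i,q}^{-1}(x)$.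 $A$ is reversible if for every $i\ge 1$ and $x\in X_i$ the map $q\mapsto\varphi_i(q,x)$ is a permutation of $Q$; $A$ is bi-reversible if it is invertible and both $A$ and $A^{-1}$ are reversible. For $q\in Q$ the map $A_q\colon X^*\to X^*$ is given by $A_q(\epsilon)=\epsilon$ and $A_q(x_1\ldots x_t)=\psi_1(q^{(1)},x_1)\ldots\psi_t(q^{(t)},x_t)$, where $q^{(1)}=q$ and $q^{(i+1)}=\varphi_i(q^{(i)},x_i)$ for $1\le i<t$. If $A$ is invertible, each $A_q$ is a permutation of $X^*$, and the group generated by $A$ is $G(A):=\langle A_q\colon q\in Q\rangle$, the group generated by these permutations under composition. *)

theory Defs
  imports "HOL-Algebra.Algebra"
begin

text \<open>
  Every alphabet \<open>X\<^sub>i\<close> is the type \<^typ>\<open>bool\<close> (\<^const>\<open>False\<close> for 0, \<^const>\<open>True\<close> for 1), so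
  \<open>X\<^sup>*\<close> is the type of all lists of booleans.
  The level index \<open>i\<close> starts at 1: the values of \<open>trans\<close> and \<open>out\<close> at index 0, and at
  arguments outside \<open>states\<close>, play no role.
\<close>

record 'q automaton =
  states :: "'q set"
  trans :: "nat \<Rightarrow> 'q \<Rightarrow> bool \<Rightarrow> 'q"
  out :: "nat \<Rightarrow> 'q \<Rightarrow> bool \<Rightarrow> bool"

definition is_automaton :: "'q automaton \<Rightarrow> bool" where
  "is_automaton A \<longleftrightarrow>
     finite (states A) \<and> (\<forall>i\<ge>1. \<forall>q\<in>states A. \<forall>x. trans A i q x \<in> states A)"

definition mealy :: "'q automaton \<Rightarrow> bool" where
  "mealy A \<longleftrightarrow>
     (\<forall>i\<ge>1. \<forall>j\<ge>1. \<forall>q\<in>states A. \<forall>x.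
        trans A i q x = trans A j q x \<and> out A i q x = out A j q x)"

definition invertible :: "'q automaton \<Rightarrow> bool" where
  "invertible A \<longleftrightarrow> (\<forall>i\<ge>1. \<forall>q\<in>states A. bij (out A i q))"

definition inverse_automaton :: "'q automaton \<Rightarrow> 'q automaton" where
  "inverse_automaton A =
     \<lparr>states = states A,
      trans = (\<lambda>i q x. trans A i q (inv_into UNIV (out A i q) x)),
      out = (\<lambda>i q x. inv_into UNIV (out A i q) x)\<rparr>"

definition reversible :: "'q automaton \<Rightarrow> bool" where
  "reversible A \<longleftrightarrow>
     (\<forall>i\<ge>1. \<forall>x. bij_betw (\<lambda>q. trans A i q x) (states A) (states A))"

definition bireversible :: "'q automaton \<Rightarrow> bool" where
  "bireversible A \<longleftrightarrow>
     invertible A \<and> reversible A \<and> reversible (inverse_automaton A)"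

text \<open>\<open>run A i q w\<close> is the output produced on \<open>w\<close> when reading starts at level \<open>i\<close> in state \<open>q\<close>.\<close>

primrec run :: "'q automaton \<Rightarrow> nat \<Rightarrow> 'q \<Rightarrow> bool list \<Rightarrow> bool list" where
  "run A i q [] = []"
| "run A i q (x # w) = out A i q x # run A (Suc i) (trans A i q x) w"

definition state_map :: "'q automaton \<Rightarrow> 'q \<Rightarrow> bool list \<Rightarrow> bool list" where
  "state_map A q = run A 1 q"

text \<open>
  \<^const>\<open>subgroup_generated\<close> intersects the generating set with the carrier of the ambient group;
  by \<open>state_map_in_BijGroup\<close> below nothing is lost here if \<open>A\<close> is an invertible automaton.
\<close>

definition automaton_group :: "'q automaton \<Rightarrow> (bool list \<Rightarrow> bool list) monoid" where
  "automaton_group A = subgroup_generated (BijGroup UNIV) (state_map A ` states A)"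

text \<open>
  The type argument records where the states live.  Groups generated by automata with the same
  number of states do not depend on it up to renaming, provided that it has enough elements.
\<close>

definition BIR22 :: "'q itself \<Rightarrow> (bool list \<Rightarrow> bool list) monoid set" where
  "BIR22 T =
     {automaton_group A | A :: 'q automaton.
        is_automaton A \<and> card (states A) = 2 \<and> bireversible A}"

definition BIRM22 :: "'q itself \<Rightarrow> (bool list \<Rightarrow> bool list) monoid set" where
  "BIRM22 T =
     {automaton_group A | A :: 'q automaton.
        is_automaton A \<and> card (states A) = 2 \<and> bireversible A \<and> mealy A}"

abbreviation trivial_gp :: "(bool list \<Rightarrow> bool list) monoid" where
  "trivial_gp \<equiv> singleton_group id"

abbreviation Z2 :: "int monoid" where "Z2 \<equiv> integer_mod_group 2"
abbreviation Z4 :: "int monoid" where "Z4 \<equiv> integer_mod_group 4"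

lemma length_run [simp]: "length (run A i q w) = length w"
  by (induction w arbitrary: i q) auto

lemma bij_run:
  assumes "is_automaton A" "invertible A" "i \<ge> 1" "q \<in> states A"
  shows "bij (run A i q)"
proof (rule bijI)
  have step: "bij (out A i q)" "trans A i q x \<in> states A" if "i \<ge> 1" "q \<in> states A" for i q x
    using assms(1,2) that by (auto simp: is_automaton_def invertible_def)
  show "inj (run A i q)"
  proof (rule injI)
    fix v w assume "run A i q v = run A i q w"
    then show "v = w" using assms(3,4)
    proof (induction v arbitrary: i q w)
      case Nil
      then show ?case by (metis length_run length_0_conv)
    next
      case (Cons x v)
      then obtain y u where w: "w = y # u"
        by (metis length_run length_Suc_conv)
      with Cons.prems step(1)[of i q] have "x = y"
        by (auto dest: bij_is_inj injD)
      with Cons w step(2)[of i q x] show ?case by auto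
    qed
  qed
  have "\<exists>v. run A i q v = w" for w
    using assms(3,4)
  proof (induction w arbitrary: i q)
    case Nil
    show ?case by (rule exI[of _ "[]"]) simp
  next
    case (Cons y w)
    from step(1)[OF Cons.prems] obtain x where x: "out A i q x = y"
      by (metis bij_pointE)
    from Cons.IH[of "Suc i" "trans A i q x"] Cons.prems step(2)[OF Cons.prems]
    obtain v where "run A (Suc i) (trans A i q x) v = w" by auto
    with x show ?case by (intro exI[of _ "x # v"]) simp
  qed
  then show "surj (run A i q)" by (metis surj_def)
qed

lemma state_map_in_BijGroup:
  assumes "is_automaton A" "invertible A" "q \<in> states A"
  shows "state_map A q \<in> carrier (BijGroup UNIV)"
  using bij_run[OF assms(1,2) _ assms(3), of 1]
  by (simp add: state_map_def BijGroup_def Bij_def)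

end

theory Submission
  imports Defs
begin

text \<open>
  Identify states and letters with elements of the field with two elements.  Bi-reversibility at
  level \<open>i\<close> means that the output is \<open>x + e\<^sub>i + k\<^sub>i s\<close> and the next state is
  \<open>s + c\<^sub>i + d\<^sub>i x\<close> with \<open>k\<^sub>i d\<^sub>i = 0\<close>.  When \<open>s'\<close> and then \<open>s\<close> act on a word, the composite flips
  letter \<open>i\<close> iff \<open>k\<^sub>i = 1\<close> and the current states differ, and whether they differ changes iff
  \<open>d\<^sub>i e\<^sub>i = 1\<close>, independently of the word.  So the composite is a translation that depends only on
  whether \<open>s = s'\<close>: the generators \<open>a\<close> and \<open>b\<close> satisfy \<open>a b = b a\<close>, \<open>a\<^sup>2 = b\<^sup>2\<close> and \<open>a\<^sup>4 = 1\<close>, and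
  the group is a quotient of \<open>\<int>\<^sub>2 \<times> \<int>\<^sub>4\<close>.  In the Mealy case \<open>k = 0\<close> or \<open>d = 0\<close>
  at all levels simultaneously, so \<open>a\<^sup>2 = 1\<close>.
\<close>

section \<open>Recognising a generated subgroup as a cyclic group or a product of two\<close>

context group
begin

text \<open>The image of \<open>f\<close> is a subgroup containing \<open>S\<close>, so it contains
  \<open>generate G S\<close>; the reverse inclusion is assumed. Hence \<open>f\<close> is an
  isomorphism onto the generated subgroup.\<close>

lemma subgroup_generated_cong_hom_image:
  assumes H: "group H" and f: "f \<in> hom H G" "inj_on f (carrier H)"
    and S: "S \<subseteq> f ` carrier H" "f ` carrier H \<subseteq> generate G S"
  shows "subgroup_generated G S \<cong> H"
proof -
  interpret f: group_hom H G f
    by (intro group_hom.intro group_hom_axioms.intro H f(1) is_group)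
  have SG: "S \<subseteq> carrier G"
    using S(1) f.hom_closed by auto
  have "subgroup (f ` carrier H) G"
    by (rule f.img_is_subgroup)
  then have "generate G S \<subseteq> f ` carrier H"
    using S(1) by (rule generate_subgroup_incl[rotated])
  with S(2) have eq: "carrier (subgroup_generated G S) = f ` carrier H"
    using SG by (auto simp: carrier_subgroup_generated Int_absorb1)
  have "f \<in> iso H (subgroup_generated G S)"
    using f by (auto simp: iso_def hom_def bij_betw_def eq)
  then show ?thesis
    using group.iso_sym[OF H] is_isoI by blast
qed

lemma pow_mod_eq:
  assumes "a \<in> carrier G" "a [^] (n::nat) = \<one>"
  shows "a [^] (k mod n) = a [^] k"
proof -
  have "a [^] k = a [^] (n * (k div n) + k mod n)" by simp
  also have "\<dots> = (a [^] n) [^] (k div n) \<otimes> a [^] (k mod n)"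
    using assms(1) by (simp add: nat_pow_mult nat_pow_pow)
  finally show ?thesis using assms by simp
qed

lemma pow_nat_add_mod:
  assumes "a \<in> carrier G" "a [^] (n::nat) = \<one>" "0 \<le> i" "0 \<le> j"
  shows "a [^] nat ((i + j) mod int n) = a [^] nat i \<otimes> a [^] nat j"
proof -
  have "nat ((i + j) mod int n) = (nat i + nat j) mod n"
    using assms(3,4) by (simp add: nat_mod_distrib nat_add_distrib)
  then show ?thesis
    using assms(1,2) by (simp add: pow_mod_eq nat_pow_mult)
qed

lemma nat_pow_in_generate:
  assumes "S \<subseteq> carrier G" "x \<in> generate G S"
  shows "x [^] (n::nat) \<in> generate G S"
  using subgroup_int_pow_closed[OF generate_is_subgroup[OF assms(1)] assms(2), of "int n"]
  by (simp add: int_pow_int)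

text \<open>The isomorphism sends a residue to the corresponding power of \<open>a\<close>, and
  \<open>nontriv\<close> makes its kernel trivial. \<open>S\<close> may hold further powers of
  \<open>a\<close>, as for a pair \<open>{a, b}\<close> in which \<open>b\<close> is one.\<close>

lemma subgroup_generated_cong_integer_mod_group:
  assumes a: "a \<in> carrier G" "a [^] n = \<one>"
    and nontriv: "\<And>i. i < n \<Longrightarrow> a [^] i = \<one> \<Longrightarrow> i = 0" and n: "n > 0"
    and S: "a \<in> S" "\<And>x. x \<in> S \<Longrightarrow> \<exists>i. x = a [^] (i::nat)"
  shows "subgroup_generated G S \<cong> integer_mod_group n"
proof (rule subgroup_generated_cong_hom_image)
  let ?Z = "integer_mod_group n" and ?f = "\<lambda>i. a [^] nat i"
  have SG: "S \<subseteq> carrier G" using S(2) a(1) by fastforce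
  show hom: "?f \<in> hom ?Z G"
    using n a by (auto simp: hom_def carrier_integer_mod_group pow_nat_add_mod simp del: pow_nat)
  interpret f: group_hom ?Z G ?f
    by (intro group_hom.intro group_hom_axioms.intro hom is_group) simp
  show "inj_on ?f (carrier ?Z)"
    unfolding f.inj_on_one_iff
  proof (intro allI impI)
    fix i assume "i \<in> carrier ?Z" and eq: "a [^] nat i = \<one>"
    then have i: "0 \<le> i" "i < int n"
      using n by (auto simp: carrier_integer_mod_group)
    then have "nat i < n" by auto
    from nontriv[OF this eq] show "i = \<one>\<^bsub>?Z\<^esub>"
      using i by simp
  qed
  show "S \<subseteq> ?f ` carrier ?Z"
  proof
    fix x assume "x \<in> S"
    then obtain i :: nat where "x = a [^] (i mod n)" using S(2) a pow_mod_eq by metis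
    then show "x \<in> ?f ` carrier ?Z"
      using n by (intro image_eqI[of _ _ "int (i mod n)"])
        (simp_all add: carrier_integer_mod_group del: of_nat_mod pow_nat)
  qed
  show "?f ` carrier ?Z \<subseteq> generate G S"
    using nat_pow_in_generate[OF SG generate.incl[OF S(1)]] by auto
qed simp

text \<open>The isomorphism is \<open>(i, j)\<close> to \<open>a [^] i \<otimes> b [^] j\<close>.
  The two factors need only lie in \<open>generate G S\<close>, so that an element such as
  \<open>inv a \<otimes> b\<close> can span one of them.\<close>

lemma subgroup_generated_cong_DirProd:
  assumes a: "a \<in> carrier G" "a [^] m = \<one>" and b: "b \<in> carrier G" "b [^] n = \<one>"
    and comm: "a \<otimes> b = b \<otimes> a"
    and nontriv: "\<And>i j. i < m \<Longrightarrow> j < n \<Longrightarrow> a [^] i \<otimes> b [^] j = \<one> \<Longrightarrow> i = 0 \<and> j = 0"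
    and mn: "m > 0" "n > 0"
    and S: "S \<subseteq> carrier G" "a \<in> generate G S" "b \<in> generate G S"
      "\<And>x. x \<in> S \<Longrightarrow> \<exists>i j. x = a [^] (i::nat) \<otimes> b [^] (j::nat)"
  shows "subgroup_generated G S \<cong> integer_mod_group m \<times>\<times> integer_mod_group n"
proof (rule subgroup_generated_cong_hom_image)
  let ?Z = "integer_mod_group m \<times>\<times> integer_mod_group n"
  let ?f = "\<lambda>(i, j). a [^] nat i \<otimes> b [^] nat j"
  show Z: "group ?Z" by (simp add: DirProd_group)
  have pows: "a [^] (i::nat) \<otimes> b [^] (j::nat) = b [^] j \<otimes> a [^] i" for i j
    using comm a(1) b(1) by (metis group_commutes_pow nat_pow_closed)
  have "?f ((i, j) \<otimes>\<^bsub>?Z\<^esub> (i', j')) = ?f (i, j) \<otimes> ?f (i', j')"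
    if "0 \<le> i" "0 \<le> j" "0 \<le> i'" "0 \<le> j'" for i j i' j'
  proof -
    have "?f ((i, j) \<otimes>\<^bsub>?Z\<^esub> (i', j')) = (a [^] nat i \<otimes> a [^] nat i') \<otimes> (b [^] nat j \<otimes> b [^] nat j')"
      using that a b by (simp add: pow_nat_add_mod del: pow_nat)
    also have "\<dots> = a [^] nat i \<otimes> (a [^] nat i' \<otimes> b [^] nat j) \<otimes> b [^] nat j'"
      using a b by (simp add: m_assoc)
    also have "\<dots> = ?f (i, j) \<otimes> ?f (i', j')"
      unfolding pows[of "nat i'" "nat j"] using a b by (simp add: m_assoc)
    finally show ?thesis .
  qed
  then show hom: "?f \<in> hom ?Z G"
    using mn a(1) b(1) by (auto simp: hom_def carrier_integer_mod_group simp del: pow_nat)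
  interpret f: group_hom ?Z G ?f
    by (intro group_hom.intro group_hom_axioms.intro hom is_group Z)
  show "inj_on ?f (carrier ?Z)"
    unfolding f.inj_on_one_iff
  proof clarify
    fix i j assume "(i, j) \<in> carrier ?Z" and eq: "a [^] nat i \<otimes> b [^] nat j = \<one>"
    then have "0 \<le> i" "i < int m" "0 \<le> j" "j < int n"
      using mn by (auto simp: carrier_integer_mod_group)
    then have "nat i < m" "nat j < n" by auto
    from nontriv[OF this eq] have "i = 0" "j = 0"
      using \<open>0 \<le> i\<close> \<open>0 \<le> j\<close> by auto
    then show "(i, j) = \<one>\<^bsub>?Z\<^esub>" by simp
  qed
  show "S \<subseteq> ?f ` carrier ?Z"
  proof
    fix x assume "x \<in> S"
    then obtain i j :: nat where "x = a [^] (i mod m) \<otimes> b [^] (j mod n)"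
      using S(4) a b pow_mod_eq by metis
    then show "x \<in> ?f ` carrier ?Z"
      using mn by (intro image_eqI[of _ _ "(int (i mod m), int (j mod n))"])
        (simp_all add: carrier_integer_mod_group del: of_nat_mod pow_nat)
  qed
  show "?f ` carrier ?Z \<subseteq> generate G S"
    using nat_pow_in_generate[OF S(1)] S(2,3) generate.eng[of _ G S] by (auto simp del: pow_nat)
qed

end

section \<open>Groups generated by two commuting elements with equal squares and trivial fourth
  powers\<close>

locale square_pair = group G for G (structure) +
  fixes a b
  assumes a: "a \<in> carrier G" and b: "b \<in> carrier G"
    and comm: "a \<otimes> b = b \<otimes> a" and squares: "a \<otimes> a = b \<otimes> b"
    and fourth: "(a \<otimes> a) \<otimes> (a \<otimes> a) = \<one>"
begin

lemma a_pow_4: "a [^] (4::nat) = \<one>"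
  using a fourth by (simp add: numeral_eq_Suc m_assoc)

text \<open>First of five cases that together are exhaustive: if \<open>a\<^sup>2 = 1\<close>, they
  are told apart by which of \<open>a = 1\<close>, \<open>b = 1\<close>, \<open>a = b\<close> hold;
  otherwise by whether \<open>b\<close> is \<open>a\<close> or \<open>a\<^sup>3\<close>.\<close>

lemma cong_trivial:
  assumes "a = \<one>" "b = \<one>"
  shows "subgroup_generated G {a, b} \<cong> singleton_group x"
  by (rule subgroup_generated_cong_hom_image[of _ "\<lambda>_. \<one>"])
     (use assms in \<open>auto simp: hom_def generate.one\<close>)

lemma cong_Z2:
  assumes sq: "a \<otimes> a = \<one>" and "a \<noteq> \<one> \<or> b \<noteq> \<one>" "a = \<one> \<or> b = \<one> \<or> a = b"
  shows "subgroup_generated G {a, b} \<cong> Z2"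
proof -
  \<comment> \<open>Either of \<open>a\<close> and \<open>b\<close> may be the identity, so the
    argument runs for an arbitrary nontrivial generator \<open>x\<close>.\<close>
  have Z2: "subgroup_generated G {a, b} \<cong> Z2"
    if x: "x \<in> {a, b}" "x \<noteq> \<one>" and S: "{a, b} \<subseteq> {\<one>, x}" for x
  proof (rule subgroup_generated_cong_integer_mod_group)
    show "x \<in> carrier G" using x a b by auto
    then show "x [^] (2::nat) = \<one>" using x(1) sq squares by (auto simp: numeral_eq_Suc)
    show "i = 0" if "i < 2" "x [^] i = \<one>" for i :: nat
      using that x(2) \<open>x \<in> carrier G\<close> by (auto simp: less_2_cases_iff)
    show "\<exists>i. y = x [^] (i::nat)" if "y \<in> {a, b}" for y
    proof (cases "y = \<one>")
      case True then show ?thesis by (intro exI[of _ 0]) simp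
    next
      case False then show ?thesis using that S \<open>x \<in> carrier G\<close> by (intro exI[of _ 1]) auto
    qed
  qed (use x in auto)
  show ?thesis
    using Z2[of a] Z2[of b] assms(2,3) by auto
qed

lemma cong_Z2_Z2:
  assumes sq: "a \<otimes> a = \<one>" and "a \<noteq> \<one>" "b \<noteq> \<one>" "a \<noteq> b"
  shows "subgroup_generated G {a, b} \<cong> Z2 \<times>\<times> Z2"
proof (rule subgroup_generated_cong_DirProd[OF a _ b _ comm])
  \<comment> \<open>Otherwise \<open>a \<otimes> b = a \<otimes> a\<close>, and cancelling gives
    \<open>b = a\<close>.\<close>
  have "a \<otimes> b \<noteq> \<one>"
    using assms a b by (metis l_cancel)
  then show "i = 0 \<and> j = 0" if "i < 2" "j < 2" "a [^] i \<otimes> b [^] j = \<one>" for i j :: nat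
    using that assms a b by (auto simp: less_2_cases_iff)
  show "\<exists>i j. x = a [^] (i::nat) \<otimes> b [^] (j::nat)" if "x \<in> {a, b}" for x
  proof (cases "x = a")
    case True then show ?thesis using a b by (intro exI[of _ 1] exI[of _ 0]) auto
  next
    case False then show ?thesis using a b that by (intro exI[of _ 0] exI[of _ 1]) auto
  qed
qed (use a b sq squares in \<open>auto simp: numeral_eq_Suc intro: generate.incl\<close>)

lemma cong_Z4:
  assumes sq: "a \<otimes> a \<noteq> \<one>" and "b = a \<or> b = a \<otimes> a \<otimes> a"
  shows "subgroup_generated G {a, b} \<cong> Z4"
proof (rule subgroup_generated_cong_integer_mod_group[OF a a_pow_4])
  show "i = 0" if "i < 4" "a [^] i = \<one>" for i :: nat
  proof -
    have "a \<noteq> \<one>" using sq by auto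
    moreover have "a \<otimes> a \<otimes> a \<noteq> \<one>"
      using fourth a sq by (metis l_cancel m_assoc m_closed one_closed r_one)
    moreover have "i \<in> {0, 1, 2, 3}" using that(1) by auto
    ultimately show ?thesis using that(2) sq a by (auto simp: numeral_eq_Suc)
  qed
  show "\<exists>i. x = a [^] (i::nat)" if "x \<in> {a, b}" for x
  proof (cases "x = a")
    case True then show ?thesis using a by (intro exI[of _ 1]) auto
  next
    case False then show ?thesis using a that assms(2) by (intro exI[of _ 3]) (auto simp: numeral_eq_Suc)
  qed
qed auto

text \<open>The involution \<open>k = inv a \<otimes> b\<close> spans the factor of order two and
  \<open>a\<close> the one of order four. They meet trivially: \<open>k\<close> is neither
  \<open>1\<close> nor \<open>a\<^sup>2\<close> by the choice of \<open>b\<close>, and neither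
  \<open>a\<close> nor \<open>a\<^sup>3\<close> because their squares are nontrivial.\<close>

lemma cong_Z2_Z4:
  assumes sq: "a \<otimes> a \<noteq> \<one>" and ne: "b \<noteq> a" "b \<noteq> a \<otimes> a \<otimes> a"
  shows "subgroup_generated G {a, b} \<cong> Z2 \<times>\<times> Z4"
proof -
  define k where "k = inv a \<otimes> b"
  have k: "k \<in> carrier G" using a b by (simp add: k_def)
  have ak: "a \<otimes> k = b" using a b by (simp add: k_def m_assoc[symmetric])
  have ka: "k \<otimes> a = b"
    using a b comm by (metis ak inv_solve_left k k_def m_assoc m_closed)
  \<comment> \<open>The right side is \<open>b\<^sup>2 = a\<^sup>2\<close>, so cancelling
    \<open>a\<close> twice leaves \<open>k\<^sup>2 = 1\<close>.\<close>
  have "a \<otimes> (a \<otimes> (k \<otimes> k)) = (a \<otimes> k) \<otimes> (a \<otimes> k)"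
    using a k ak ka by (metis m_assoc m_closed)
  then have kk: "k \<otimes> k = \<one>"
    using a b k ak squares by (metis l_cancel m_assoc m_closed one_closed r_one)
  have k1: "k \<noteq> \<one>" using ne ak a by auto
  have k2: "k \<noteq> a \<otimes> a" using ne ak a by (metis m_assoc)
  \<comment> \<open>Since \<open>k\<close> is its own inverse, a relation
    \<open>k \<otimes> x = \<one>\<close> would mean \<open>x = k\<close>.\<close>
  have *: "k \<otimes> x \<noteq> \<one>" if "x \<in> carrier G" "k \<noteq> x" for x
    using that kk k by (metis l_cancel)
  have xk: "x = k \<Longrightarrow> x \<otimes> x = \<one>" for x using kk by simp
  show ?thesis
  proof (rule subgroup_generated_cong_DirProd[OF k _ a a_pow_4])
    show "i = 0 \<and> j = 0" if ij: "i < 2" "j < 4" "k [^] i \<otimes> a [^] j = \<one>" for i j :: nat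
    proof -
      have a1: "a \<noteq> \<one>" using sq by auto
      have a3: "a \<otimes> a \<otimes> a \<noteq> \<one>"
        using fourth a sq by (metis l_cancel m_assoc m_closed one_closed r_one)
      have ka1: "k \<noteq> a" using kk sq by auto
      have "(a \<otimes> a \<otimes> a) \<otimes> (a \<otimes> a \<otimes> a) = ((a \<otimes> a) \<otimes> (a \<otimes> a)) \<otimes> (a \<otimes> a)"
        using a by (simp add: m_assoc)
      then have ka3: "k \<noteq> a \<otimes> a \<otimes> a" using xk[of "a \<otimes> a \<otimes> a"] sq fourth a by auto
      have "i \<in> {0, 1}" "j \<in> {0, 1, 2, 3}" using ij(1,2) by auto
      with ij(3) show ?thesis
        using a k a1 a3 sq k1 *[of a, OF a ka1] *[of "a \<otimes> a", OF _ k2] *[of "a \<otimes> a \<otimes> a", OF _ ka3]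
        by (auto simp: numeral_eq_Suc)
    qed
    show "{a, b} \<subseteq> carrier G" using a b by auto
    then show "a \<in> generate G {a, b}" "k \<in> generate G {a, b}"
      unfolding k_def by (auto intro: generate.incl generate.inv generate.eng)
    show "\<exists>i j. x = k [^] (i::nat) \<otimes> a [^] (j::nat)" if "x \<in> {a, b}" for x
    proof (cases "x = a")
      case True then show ?thesis using a k by (intro exI[of _ 0] exI[of _ 1]) auto
    next
      case False then show ?thesis using a k that ka by (intro exI[of _ 1]) auto
    qed
  qed (use kk ak ka k in \<open>auto simp: numeral_eq_Suc\<close>)
qed

end

section \<open>The permutation group of the words, and the normal form of one level of an
  automaton\<close>

lemma BijGroup_UNIV_simps:
  "carrier (BijGroup UNIV) = {f. bij f}"
  "\<one>\<^bsub>BijGroup UNIV\<^esub> = id"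
  "bij f \<Longrightarrow> bij g \<Longrightarrow> f \<otimes>\<^bsub>BijGroup UNIV\<^esub> g = f \<circ> g"
  by (auto simp: BijGroup_def Bij_def compose_def fun_eq_iff)

locale two_state_bireversible =
  fixes A :: "'q automaton" and p q :: 'q
  assumes states: "states A = {p, q}" and distinct: "p \<noteq> q"
    and automaton: "is_automaton A" and bireversible: "bireversible A"
begin

text \<open>The bit \<open>c\<^sub>i + d\<^sub>i x\<close>. Looking at \<open>p\<close> suffices,
  since by \<open>trans_eq\<close> a letter swaps the two states or fixes both. Thus
  \<open>d\<^sub>i = 1\<close> means \<open>moves i True \<noteq> moves i False\<close>.\<close>

definition moves :: "nat \<Rightarrow> bool \<Rightarrow> bool" where
  "moves i x \<longleftrightarrow> trans A i p x \<noteq> p"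

text \<open>The bit \<open>e\<^sub>i + k\<^sub>i s\<close> for the state \<open>r\<close> with bit
  \<open>s\<close>; \<open>k\<^sub>i = 1\<close> means
  \<open>negates i p \<noteq> negates i q\<close>.\<close>

definition negates :: "nat \<Rightarrow> 'q \<Rightarrow> bool" where
  "negates i r \<longleftrightarrow> out A i r False"

lemma trans_closed: "i \<ge> 1 \<Longrightarrow> r \<in> {p, q} \<Longrightarrow> trans A i r x \<in> {p, q}"
  using automaton states by (auto simp: is_automaton_def)

lemma out_eq:
  assumes "i \<ge> 1" "r \<in> {p, q}"
  shows "out A i r x \<longleftrightarrow> x \<noteq> negates i r"
proof -
  have "inj (out A i r)"
    using bireversible assms states by (auto simp: bireversible_def invertible_def bij_is_inj)
  then have "out A i r True \<noteq> out A i r False"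
    by (simp add: inj_eq)
  then show ?thesis by (cases x) (auto simp: negates_def)
qed

lemma trans_eq:
  assumes "i \<ge> 1" "r \<in> {p, q}"
  shows "trans A i r x = (if moves i x then transpose p q r else r)"
proof -
  have "inj_on (\<lambda>q. trans A i q x) {p, q}"
    using bireversible assms(1) states by (auto simp: bireversible_def reversible_def bij_betw_def)
  then have "trans A i p x \<noteq> trans A i q x"
    using distinct by auto
  then show ?thesis
    using trans_closed[OF assms(1), of p x] trans_closed[OF assms(1), of q x] assms(2) distinct
    by (auto simp: moves_def)
qed

text \<open>This is \<open>k\<^sub>i d\<^sub>i = 0\<close>. If the states negate differently, an
  output letter has opposite preimages under them. Reversibility of the inverse automaton keeps the
  two successors distinct, so both letters swap the states or neither does.\<close>

lemma constant_moves_or_negates: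
  assumes "i \<ge> 1" "negates i p \<noteq> negates i q"
  shows "moves i x = moves i y"
proof -
  have inv: "inv_into UNIV (out A i r) y \<longleftrightarrow> y \<noteq> negates i r" if "r \<in> {p, q}" for r y
  proof (rule inv_f_eq)
    show "inj (out A i r)"
      using bireversible assms(1) that states by (auto simp: bireversible_def invertible_def bij_is_inj)
  qed (use out_eq[OF assms(1) that] in auto)
  have "inj_on (\<lambda>r. trans A i r (inv_into UNIV (out A i r) y)) {p, q}" for y
    using bireversible assms(1) states
    by (auto simp: bireversible_def reversible_def bij_betw_def inverse_automaton_def)
  then have "trans A i p (y \<noteq> negates i p) \<noteq> trans A i q (y \<noteq> negates i q)" for y
    using distinct inv by (auto simp: inj_on_def)
  from this[of True] show ?thesis
    using assms distinct trans_eq[OF assms(1)] by (cases x; cases y) (auto split: if_splits)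
qed

section \<open>Composites of state maps\<close>

lemma out_out:
  assumes "i \<ge> 1" "s \<in> {p, q}" "s' \<in> {p, q}"
  shows "out A i s (out A i s' x) \<longleftrightarrow> x \<noteq> (s \<noteq> s' \<and> negates i p \<noteq> negates i q)"
  using assms by (auto simp: out_eq)

text \<open>Agreement of the two states changes exactly when \<open>d\<^sub>i e\<^sub>i = 1\<close>,
  whatever the letter \<open>x\<close>. Only \<open>negates i p\<close> appears because
  \<open>d\<^sub>i = 1\<close> makes both states negate alike.\<close>

lemma trans_out_eq_trans_iff:
  assumes "i \<ge> 1" "s \<in> {p, q}" "s' \<in> {p, q}"
  shows "trans A i s (out A i s' x) = trans A i s' x \<longleftrightarrow>
    ((s = s') \<longleftrightarrow> (moves i True = moves i False \<or> \<not> negates i p))"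
proof -
  have "trans A i s (out A i s' x) = trans A i s' x \<longleftrightarrow>
      ((s = s') \<longleftrightarrow> moves i (out A i s' x) = moves i x)"
    using assms distinct by (auto simp: trans_eq)
  moreover have "moves i (out A i s' x) = moves i x \<longleftrightarrow>
      moves i True = moves i False \<or> \<not> negates i p"
    using assms constant_moves_or_negates[OF assms(1), of True False]
    by (cases x; cases "negates i p"; cases "negates i q") (auto simp: out_eq)
  ultimately show ?thesis by simp
qed

text \<open>Whether the two current states agree is all that the induction has to carry: it decides
  the flip of the letter by \<open>out_out\<close> and its own next value by
  \<open>trans_out_eq_trans_iff\<close>. Instances give \<open>a b = b a\<close> and
  \<open>a\<^sup>2 = b\<^sup>2\<close>.\<close>

lemma run_run_cong:
  assumes "i \<ge> 1" "s \<in> {p, q}" "s' \<in> {p, q}" "t \<in> {p, q}" "t' \<in> {p, q}" "s = s' \<longleftrightarrow> t = t'"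
  shows "run A i s (run A i s' w) = run A i t (run A i t' w)"
  using assms
proof (induction w arbitrary: i s s' t t')
  case (Cons x w)
  note prems = Cons.prems(1-5)
  have "run A (Suc i) (trans A i s (out A i s' x)) (run A (Suc i) (trans A i s' x) w) =
        run A (Suc i) (trans A i t (out A i t' x)) (run A (Suc i) (trans A i t' x) w)"
    using prems Cons.prems(6)
    by (intro Cons.IH trans_closed) (simp_all only: trans_out_eq_trans_iff le_SucI)
  moreover have "out A i s (out A i s' x) = out A i t (out A i t' x)"
    using prems Cons.prems(6) by (simp only: out_out)
  ultimately show ?case by simp
qed simp

text \<open>Both pairs of states agree or disagree together at every level, so they flip the same
  letters and the flips cancel.\<close>

lemma run_4:
  assumes "i \<ge> 1" "s \<in> {p, q}" "s' \<in> {p, q}" "t \<in> {p, q}" "t' \<in> {p, q}" "s = s' \<longleftrightarrow> t = t'"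
  shows "run A i s (run A i s' (run A i t (run A i t' w))) = w"
  using assms
proof (induction w arbitrary: i s s' t t')
  case (Cons x w)
  note prems = Cons.prems(1-5)
  \<comment> \<open>The outer pair reads \<open>y\<close> and the inner one \<open>x\<close>; they
    stay in step even if \<open>x\<close> and \<open>y\<close> differ, since the update of agreement
    ignores the letter.\<close>
  define y where "y = out A i t (out A i t' x)"
  have "run A (Suc i) (trans A i s (out A i s' y)) (run A (Suc i) (trans A i s' y)
      (run A (Suc i) (trans A i t (out A i t' x)) (run A (Suc i) (trans A i t' x) w))) = w"
    using prems Cons.prems(6)
    by (intro Cons.IH trans_closed) (simp_all only: trans_out_eq_trans_iff le_SucI)
  moreover have "out A i s (out A i s' y) = x"
    unfolding y_def out_out[OF prems(1-3)] out_out[OF prems(1,4,5)] using Cons.prems(6) by auto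
  ultimately show ?case by (simp add: y_def)
qed simp

text \<open>The case \<open>d = 0\<close> at all levels: two copies started in the same state stay
  in the same state, so no letter is flipped by the composite.\<close>

lemma run_involution:
  assumes "\<And>i. i \<ge> 1 \<Longrightarrow> moves i True = moves i False" "i \<ge> 1" "s \<in> {p, q}"
  shows "run A i s (run A i s w) = w"
  using assms(2,3)
proof (induction w arbitrary: i s)
  case (Cons x w)
  moreover have "trans A i s (out A i s x) = trans A i s x"
    using Cons.prems assms(1) by (simp add: trans_out_eq_trans_iff del: One_nat_def)
  moreover have "out A i s (out A i s x) = x"
    using Cons.prems by (simp add: out_out del: One_nat_def)
  ultimately show ?case
    using trans_closed by simp
qed simp

text \<open>The case \<open>k = 0\<close> at all levels: the output does not depend on the state, so
  any two runs cancel.\<close>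

lemma run_run_id:
  assumes "\<And>i. i \<ge> 1 \<Longrightarrow> negates i p = negates i q" "i \<ge> 1" "s \<in> {p, q}" "s' \<in> {p, q}"
  shows "run A i s (run A i s' w) = w"
  using assms(2-)
proof (induction w arbitrary: i s s')
  case (Cons x w)
  moreover have "out A i s (out A i s' x) = x"
    using Cons.prems assms(1) by (simp add: out_out del: One_nat_def)
  ultimately show ?case
    using trans_closed by simp
qed simp

text \<open>All levels behave like level 1, so \<open>k\<^sub>1 d\<^sub>1 = 0\<close> puts the whole
  automaton under \<open>run_run_id\<close> or \<open>run_involution\<close>.\<close>

lemma mealy_run_involution:
  assumes "mealy A" "i \<ge> 1" "s \<in> {p, q}"
  shows "run A i s (run A i s w) = w"
proof (cases "negates 1 p = negates 1 q")
  case True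
  have "negates i r = negates 1 r" if "i \<ge> 1" "r \<in> {p, q}" for i r
    using assms(1) that states by (auto simp: mealy_def negates_def)
  with True have "negates i p = negates i q" if "i \<ge> 1" for i
    using that by blast
  then show ?thesis using assms by (intro run_run_id)
next
  case False
  then have const: "moves 1 True = moves 1 False"
    by (intro constant_moves_or_negates order_refl)
  have trans: "trans A i p x = trans A 1 p x" if "i \<ge> 1" for i x
    using assms(1) that states unfolding mealy_def by (metis insertI1 order_refl)
  have "moves i True = moves i False" if "i \<ge> 1" for i
    using const unfolding moves_def trans[OF that] .
  then show ?thesis using assms by (intro run_involution)
qed

section \<open>The generated group and its possible isomorphism types\<close>

lemma bij_state_map: "r \<in> {p, q} \<Longrightarrow> bij (state_map A r)"
  using bij_run[OF automaton _ order_refl] bireversible states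
  by (auto simp: state_map_def bireversible_def)

abbreviation "a \<equiv> state_map A p"
abbreviation "b \<equiv> state_map A q"

lemmas group_simps =
  BijGroup_UNIV_simps(1,2) BijGroup_UNIV_simps(3)[OF bij_state_map bij_state_map]
  bij_comp bij_state_map fun_eq_iff

sublocale square_pair "BijGroup UNIV" a b
proof (intro square_pair.intro square_pair_axioms.intro group_BijGroup)
  show "a \<otimes>\<^bsub>BijGroup UNIV\<^esub> b = b \<otimes>\<^bsub>BijGroup UNIV\<^esub> a"
    using run_run_cong[of 1 p q q p, folded state_map_def] distinct
    by (simp add: group_simps del: One_nat_def)
  show "a \<otimes>\<^bsub>BijGroup UNIV\<^esub> a = b \<otimes>\<^bsub>BijGroup UNIV\<^esub> b"
    using run_run_cong[of 1 p p q q, folded state_map_def]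
    by (simp add: group_simps del: One_nat_def)
  have "a (a (a (a w))) = w" for w
    using run_4[of 1 p p p p, folded state_map_def] by simp
  then show "(a \<otimes>\<^bsub>BijGroup UNIV\<^esub> a) \<otimes>\<^bsub>BijGroup UNIV\<^esub> (a \<otimes>\<^bsub>BijGroup UNIV\<^esub> a) = \<one>\<^bsub>BijGroup UNIV\<^esub>"
    by (simp add: group_simps BijGroup_UNIV_simps(3))
qed (simp_all add: group_simps)

lemma automaton_group_eq: "automaton_group A = subgroup_generated (BijGroup UNIV) {a, b}"
  by (simp add: automaton_group_def states)

lemma group_automaton_group: "group (automaton_group A)"
  by (simp add: automaton_group_eq)

lemma a_a: "a \<otimes>\<^bsub>BijGroup UNIV\<^esub> a = a \<circ> a"
  and a_a_a: "a \<otimes>\<^bsub>BijGroup UNIV\<^esub> a \<otimes>\<^bsub>BijGroup UNIV\<^esub> a = a \<circ> a \<circ> a"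
  by (simp_all add: bij_state_map bij_comp BijGroup_UNIV_simps(3))

lemmas automaton_group_cong_trivial = cong_trivial[folded automaton_group_eq, unfolded BijGroup_UNIV_simps(2)]
lemmas automaton_group_cong_Z2 = cong_Z2[folded automaton_group_eq, unfolded a_a BijGroup_UNIV_simps(2)]
lemmas automaton_group_cong_Z2_Z2 = cong_Z2_Z2[folded automaton_group_eq, unfolded a_a BijGroup_UNIV_simps(2)]
lemmas automaton_group_cong_Z4 = cong_Z4[folded automaton_group_eq, unfolded a_a_a, unfolded a_a BijGroup_UNIV_simps(2)]
lemmas automaton_group_cong_Z2_Z4 = cong_Z2_Z4[folded automaton_group_eq, unfolded a_a_a, unfolded a_a BijGroup_UNIV_simps(2)]

lemma involution_automaton_group_cases:
  assumes "a \<circ> a = id"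
  shows "automaton_group A \<cong> trivial_gp \<or> automaton_group A \<cong> Z2 \<or> automaton_group A \<cong> Z2 \<times>\<times> Z2"
  using automaton_group_cong_trivial[of id] automaton_group_cong_Z2[OF assms]
    automaton_group_cong_Z2_Z2[OF assms] by metis

lemma automaton_group_cases:
  "automaton_group A \<cong> trivial_gp \<or> automaton_group A \<cong> Z2 \<or> automaton_group A \<cong> Z2 \<times>\<times> Z2 \<or>
   automaton_group A \<cong> Z4 \<or> automaton_group A \<cong> Z2 \<times>\<times> Z4"
  using involution_automaton_group_cases automaton_group_cong_Z4 automaton_group_cong_Z2_Z4 by blast

lemma mealy_a_a: "mealy A \<Longrightarrow> a \<circ> a = id"
  using mealy_run_involution[of 1 p] by (auto simp: state_map_def fun_eq_iff)

end

section \<open>Constructing bi-reversible automata in normal form\<close>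

lemma two_state_bireversibleE:
  assumes "is_automaton A" "card (states A) = 2" "bireversible A"
  obtains p q where "two_state_bireversible A p q"
  using assms by (auto simp: card_2_iff two_state_bireversible_def)

text \<open>The converse of \<open>out_eq\<close> and \<open>trans_eq\<close>: \<open>m\<close>
  prescribes \<open>moves\<close> and \<open>n\<close> prescribes \<open>negates\<close>.\<close>

definition switch_automaton ::
    "'q \<Rightarrow> 'q \<Rightarrow> (nat \<Rightarrow> bool \<Rightarrow> bool) \<Rightarrow> (nat \<Rightarrow> 'q \<Rightarrow> bool) \<Rightarrow> 'q automaton" where
  "switch_automaton p q m n =
     \<lparr>states = {p, q},
      trans = (\<lambda>i r x. if m i x then transpose p q r else r),
      out = (\<lambda>i r x. x \<noteq> n i r)\<rparr>"

lemma switch_automaton_simps [simp]: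
  "states (switch_automaton p q m n) = {p, q}"
  "trans (switch_automaton p q m n) i r x = (if m i x then transpose p q r else r)"
  "out (switch_automaton p q m n) i r x \<longleftrightarrow> x \<noteq> n i r"
  by (simp_all add: switch_automaton_def)

lemma two_state_bireversible_switch_automaton:
  assumes "p \<noteq> q" and "\<And>i. n i p = n i q \<or> m i True = m i False"
  shows "two_state_bireversible (switch_automaton p q m n) p q"
proof
  let ?A = "switch_automaton p q m n"
  have bij: "bij (out ?A i r)" for i r
    by (rule o_bij[of "out ?A i r"]) (auto simp: fun_eq_iff)
  have inv: "inv_into UNIV (out ?A i r) y \<longleftrightarrow> y \<noteq> n i r" for i r y
    by (rule inv_f_eq[OF bij_is_inj[OF bij]]) auto
  have bij_betw: "bij_betw f {p, q} {p, q}" if "f p = q \<and> f q = p \<or> f p = p \<and> f q = q" for f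
    using that assms(1) by (auto simp: bij_betw_def)
  show "is_automaton ?A"
    by (auto simp: is_automaton_def)
  show "bireversible ?A"
    unfolding bireversible_def
  proof (intro conjI)
    show "invertible ?A" using bij by (simp add: invertible_def)
    show "reversible ?A" by (auto simp: reversible_def intro!: bij_betw)
    \<comment> \<open>The inverse automaton feeds \<open>m\<close> with the preimage of
      \<open>x\<close>, which may depend on the state; either it does not, or \<open>m\<close>
      ignores the letter.\<close>
    have "m i (x \<noteq> n i p) = m i (x \<noteq> n i q)" for i x
      using assms(2)[of i] by (cases x; cases "n i p"; cases "n i q") auto
    then show "reversible (inverse_automaton ?A)"
      unfolding reversible_def inverse_automaton_def
      by (auto simp: inv intro!: bij_betw)
  qed
qed (use assms(1) in auto)

lemma run_switch_automaton_id:
  assumes "\<And>j x. j \<ge> i \<Longrightarrow> \<not> m j x" "\<And>j. j \<ge> i \<Longrightarrow> \<not> n j r"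
  shows "run (switch_automaton p q m n) i r w = w"
  using assms by (induction w arbitrary: i) auto

lemma run_switch_automaton_Not:
  "run (switch_automaton p q (\<lambda>_ _. False) (\<lambda>_ _. True)) i r w = map Not w"
  by (induction w arbitrary: i) auto

section \<open>Possible groups in the two classes, and a witness for each\<close>

lemma automaton_group_in_BIR22:
  fixes A :: "'q automaton"
  assumes "two_state_bireversible A p q"
  shows "automaton_group A \<in> BIR22 TYPE('q)"
  using assms unfolding BIR22_def two_state_bireversible_def by auto

lemma automaton_group_in_BIRM22:
  fixes A :: "'q automaton"
  assumes "two_state_bireversible A p q" "mealy A"
  shows "automaton_group A \<in> BIRM22 TYPE('q)"
  using assms unfolding BIRM22_def two_state_bireversible_def by auto

lemma BIRM22_subset_BIR22: "BIRM22 T \<subseteq> BIR22 T"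
  by (auto simp: BIRM22_def BIR22_def)

lemma BIR22E:
  fixes T :: "'q itself"
  assumes "G \<in> BIR22 T"
  obtains A :: "'q automaton" and p q
  where "G = automaton_group A" "two_state_bireversible A p q"
  using assms unfolding BIR22_def mem_Collect_eq by (metis two_state_bireversibleE)

lemma BIRM22E:
  fixes T :: "'q itself"
  assumes "G \<in> BIRM22 T"
  obtains A :: "'q automaton" and p q
  where "G = automaton_group A" "two_state_bireversible A p q" "mealy A"
  using assms unfolding BIRM22_def mem_Collect_eq by (metis two_state_bireversibleE)

lemma BIR22_cases:
  assumes "G \<in> BIR22 T"
  shows "G \<cong> trivial_gp \<or> G \<cong> Z2 \<or> G \<cong> Z2 \<times>\<times> Z2 \<or> G \<cong> Z4 \<or> G \<cong> Z2 \<times>\<times> Z4"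
  using BIR22E[OF assms] two_state_bireversible.automaton_group_cases by metis

lemma BIRM22_cases:
  assumes "G \<in> BIRM22 T"
  shows "G \<cong> trivial_gp \<or> G \<cong> Z2 \<or> G \<cong> Z2 \<times>\<times> Z2"
  using BIRM22E[OF assms] two_state_bireversible.involution_automaton_group_cases
    two_state_bireversible.mealy_a_a by metis

lemma group_BIR22: "G \<in> BIR22 T \<Longrightarrow> group G"
  using BIR22E two_state_bireversible.group_automaton_group by metis

lemma BIRM22_trivial:
  assumes "\<exists>p q :: 'q. p \<noteq> q"
  shows "\<exists>G \<in> BIRM22 TYPE('q). G \<cong> trivial_gp"
proof -
  obtain p q :: 'q where "p \<noteq> q" using assms by auto
  define A where "A = switch_automaton p q (\<lambda>_ _. False) (\<lambda>_ _. False)"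
  interpret two_state_bireversible A p q
    unfolding A_def by (rule two_state_bireversible_switch_automaton) (use \<open>p \<noteq> q\<close> in auto)
  have "state_map A r = id" for r
    by (simp add: fun_eq_iff state_map_def A_def run_switch_automaton_id)
  moreover have "mealy A" by (simp add: A_def mealy_def)
  ultimately show ?thesis
    using automaton_group_cong_trivial[of id] automaton_group_in_BIRM22[OF two_state_bireversible_axioms]
    by metis
qed

lemma BIRM22_Z2:
  assumes "\<exists>p q :: 'q. p \<noteq> q"
  shows "\<exists>G \<in> BIRM22 TYPE('q). G \<cong> Z2"
proof -
  obtain p q :: 'q where "p \<noteq> q" using assms by auto
  \<comment> \<open>Both states complement every letter, so \<open>a = b\<close> is an
    involution.\<close>
  define A where "A = switch_automaton p q (\<lambda>_ _. False) (\<lambda>_ _. True)"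
  interpret two_state_bireversible A p q
    unfolding A_def by (rule two_state_bireversible_switch_automaton) (use \<open>p \<noteq> q\<close> in auto)
  have eq: "state_map A r = map Not" for r
    by (simp add: fun_eq_iff state_map_def A_def run_switch_automaton_Not)
  have "a [True] \<noteq> id [True]" by (simp add: eq)
  then have "a \<noteq> id" by metis
  moreover have "mealy A" by (simp add: A_def mealy_def)
  ultimately show ?thesis
    using automaton_group_cong_Z2 automaton_group_in_BIRM22[OF two_state_bireversible_axioms]
      eq mealy_a_a by metis
qed

lemma BIRM22_Z2_Z2:
  assumes "\<exists>p q :: 'q. p \<noteq> q"
  shows "\<exists>G \<in> BIRM22 TYPE('q). G \<cong> Z2 \<times>\<times> Z2"
proof -
  obtain p q :: 'q where "p \<noteq> q" using assms by auto
  \<comment> \<open>Every letter swaps the states and only \<open>q\<close> negates: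
    \<open>a\<close> flips the letters at even positions, \<open>b\<close> those at odd
    positions.\<close>
  define A where "A = switch_automaton p q (\<lambda>_ _. True) (\<lambda>_ r. r = q)"
  interpret two_state_bireversible A p q
    unfolding A_def by (rule two_state_bireversible_switch_automaton) (use \<open>p \<noteq> q\<close> in auto)
  have "a [False, False] = [False, True]" "b [False, False] = [True, False]"
    using \<open>p \<noteq> q\<close> by (simp_all add: A_def state_map_def)
  then have "a \<noteq> id" "b \<noteq> id" "a \<noteq> b" by auto
  moreover have "mealy A" by (simp add: A_def mealy_def)
  ultimately show ?thesis
    using automaton_group_cong_Z2_Z2 automaton_group_in_BIRM22[OF two_state_bireversible_axioms]
      mealy_a_a by metis
qed

text \<open>Witness for \<open>\<int>\<^sub>4\<close>: both \<open>a\<^sup>2\<close> and \<open>a\<^sup>-\<^sup>1 b\<close> flip exactly the second letter.\<close>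

lemma BIR22_Z4:
  assumes "\<exists>p q :: 'q. p \<noteq> q"
  shows "\<exists>G \<in> BIR22 TYPE('q). G \<cong> Z4"
proof -
  obtain p q :: 'q where "p \<noteq> q" using assms by auto
  define A where "A = switch_automaton p q (\<lambda>i x. i = Suc 0 \<and> x)
    (\<lambda>i r. i = Suc 0 \<or> i = Suc (Suc 0) \<and> r = q)"
  interpret two_state_bireversible A p q
    unfolding A_def by (rule two_state_bireversible_switch_automaton) (use \<open>p \<noteq> q\<close> in auto)
  \<comment> \<open>From level 3 on nothing is swapped or negated, so words with fewer than two
    letters and the first two letters of longer ones decide everything.\<close>
  have tail: "run A (Suc (Suc (Suc 0))) r w = w" for r w
    unfolding A_def by (rule run_switch_automaton_id) auto
  have step: "trans A i r x = (if i = Suc 0 \<and> x then transpose p q r else r)"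
    "out A i r x \<longleftrightarrow> x \<noteq> (i = Suc 0 \<or> i = Suc (Suc 0) \<and> r = q)" for i r x
    by (auto simp: A_def)
  have "b w = a (a (a w))" for w
  proof -
    consider "w = []" | x where "w = [x]" | x y v where "w = x # y # v"
      by (metis list.exhaust)
    then show ?thesis
      using \<open>p \<noteq> q\<close> by cases (auto simp: state_map_def tail step)
  qed
  then have "b = a \<circ> a \<circ> a" by auto
  moreover have "(a \<circ> a) [False, False] \<noteq> id [False, False]"
    using \<open>p \<noteq> q\<close> by (simp add: state_map_def step)
  then have "a \<circ> a \<noteq> id" by metis
  ultimately show ?thesis
    using automaton_group_cong_Z4 automaton_group_in_BIR22[OF two_state_bireversible_axioms]
    by blast
qed

text \<open>
  Witness for \<open>\<int>\<^sub>2 \<times> \<int>\<^sub>4\<close>: \<open>a\<^sup>2\<close> flips the third letter only, \<open>a\<^sup>-\<^sup>1 b\<close> the first and the third.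
\<close>

lemma BIR22_Z2_Z4:
  assumes "\<exists>p q :: 'q. p \<noteq> q"
  shows "\<exists>G \<in> BIR22 TYPE('q). G \<cong> Z2 \<times>\<times> Z4"
proof -
  obtain p q :: 'q where "p \<noteq> q" using assms by auto
  define A where "A = switch_automaton p q (\<lambda>i x. i = Suc (Suc 0) \<and> x)
    (\<lambda>i r. i = Suc (Suc 0) \<or> (i = Suc 0 \<or> i = Suc (Suc (Suc 0))) \<and> r = q)"
  interpret two_state_bireversible A p q
    unfolding A_def by (rule two_state_bireversible_switch_automaton) (use \<open>p \<noteq> q\<close> in auto)
  \<comment> \<open>The third letter detects \<open>a\<^sup>2\<close>; the first separates
    \<open>b\<close>, which flips it, from \<open>a\<close> and \<open>a\<^sup>3\<close>, which fix
    it.\<close>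
  have "(a \<circ> a) [False, False, False] \<noteq> id [False, False, False]"
    "b [False] \<noteq> a [False]" "b [False] \<noteq> (a \<circ> a \<circ> a) [False]"
    using \<open>p \<noteq> q\<close> by (simp_all add: A_def state_map_def)
  then have "a \<circ> a \<noteq> id" "b \<noteq> a" "b \<noteq> a \<circ> a \<circ> a" by metis+
  then show ?thesis
    using automaton_group_cong_Z2_Z4 automaton_group_in_BIR22[OF two_state_bireversible_axioms]
    by blast
qed

section \<open>Telling the five groups apart\<close>

lemma BIRM22_not_cong:
  assumes G: "G \<in> BIRM22 T" and "\<not> trivial_gp \<cong> K" "\<not> Z2 \<cong> K" "\<not> Z2 \<times>\<times> Z2 \<cong> K"
  shows "\<not> G \<cong> K"
proof
  assume "G \<cong> K"
  \<comment> \<open>Reversing the isomorphisms from \<open>BIRM22_cases\<close> by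
    \<open>group.iso_sym\<close> requires \<open>G\<close> to be a group.\<close>
  have "group G" using G BIRM22_subset_BIR22 group_BIR22 by blast
  note flip = iso_trans[OF group.iso_sym[OF this] \<open>G \<cong> K\<close>]
  show False
    using BIRM22_cases[OF G] assms(2-4) flip[of trivial_gp] flip[of Z2] flip[of "Z2 \<times>\<times> Z2"]
    by blast
qed

lemma not_cong_if_card_neq: "card (carrier G) \<noteq> card (carrier H) \<Longrightarrow> \<not> G \<cong> H"
  using iso_same_card by blast

text \<open>Both groups have order four, so squares must separate them: in
  \<open>Z2 \<times>\<times> Z2\<close> all squares are trivial, whereas \<open>1 + 1\<close> is
  nonzero in \<open>Z4\<close>.\<close>

lemma Z2_Z2_not_cong_Z4: "\<not> Z2 \<times>\<times> Z2 \<cong> Z4"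
proof
  assume "Z2 \<times>\<times> Z2 \<cong> Z4"
  then obtain f where f: "f \<in> hom (Z2 \<times>\<times> Z2) Z4" and bij: "bij_betw f (carrier (Z2 \<times>\<times> Z2)) (carrier Z4)"
    by (auto simp: is_iso_def iso_def)
  have "1 \<in> f ` carrier (Z2 \<times>\<times> Z2)"
    using bij by (auto simp: bij_betw_def carrier_integer_mod_group)
  then obtain x where x: "x \<in> carrier (Z2 \<times>\<times> Z2)" "f x = 1" by auto
  have "x \<otimes>\<^bsub>Z2 \<times>\<times> Z2\<^esub> x = \<one>\<^bsub>Z2 \<times>\<times> Z2\<^esub>"
    by (cases x) (simp flip: mult_2)
  moreover have "f \<one>\<^bsub>Z2 \<times>\<times> Z2\<^esub> = 0"
    using hom_one[OF f] by (simp add: DirProd_group)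
  ultimately show False
    using hom_mult[OF f x(1) x(1)] x(2) by simp
qed

text \<open>The assumption provides room for two states; over a smaller type both classes would be
  empty.\<close>

theorem theorem5:
  assumes "\<exists>p q :: 'q. p \<noteq> q"
  shows
   "((\<forall>G \<in> BIR22 TYPE('q).
        G \<cong> trivial_gp \<or> G \<cong> Z2 \<or> G \<cong> Z2 \<times>\<times> Z2 \<or> G \<cong> Z4 \<or> G \<cong> Z2 \<times>\<times> Z4) \<and>
     (\<exists>G \<in> BIR22 TYPE('q). G \<cong> trivial_gp) \<and>
     (\<exists>G \<in> BIR22 TYPE('q). G \<cong> Z2) \<and>
     (\<exists>G \<in> BIR22 TYPE('q). G \<cong> Z2 \<times>\<times> Z2) \<and>
     (\<exists>G \<in> BIR22 TYPE('q). G \<cong> Z4) \<and>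
     (\<exists>G \<in> BIR22 TYPE('q). G \<cong> Z2 \<times>\<times> Z4)) \<and>
    (\<not> trivial_gp \<cong> Z2 \<and> \<not> trivial_gp \<cong> Z2 \<times>\<times> Z2 \<and> \<not> trivial_gp \<cong> Z4 \<and>
     \<not> trivial_gp \<cong> Z2 \<times>\<times> Z4 \<and> \<not> Z2 \<cong> Z2 \<times>\<times> Z2 \<and> \<not> Z2 \<cong> Z4 \<and> \<not> Z2 \<cong> Z2 \<times>\<times> Z4 \<and>
     \<not> Z2 \<times>\<times> Z2 \<cong> Z4 \<and> \<not> Z2 \<times>\<times> Z2 \<cong> Z2 \<times>\<times> Z4 \<and> \<not> Z4 \<cong> Z2 \<times>\<times> Z4) \<and>
    (BIRM22 TYPE('q) \<subseteq> BIR22 TYPE('q) \<and>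
     (\<forall>G \<in> BIRM22 TYPE('q). G \<cong> trivial_gp \<or> G \<cong> Z2 \<or> G \<cong> Z2 \<times>\<times> Z2) \<and>
     (\<exists>G \<in> BIRM22 TYPE('q). G \<cong> trivial_gp) \<and>
     (\<exists>G \<in> BIRM22 TYPE('q). G \<cong> Z2) \<and>
     (\<exists>G \<in> BIRM22 TYPE('q). G \<cong> Z2 \<times>\<times> Z2) \<and>
     \<not> (\<exists>G \<in> BIRM22 TYPE('q). G \<cong> Z4) \<and>
     \<not> (\<exists>G \<in> BIRM22 TYPE('q). G \<cong> Z2 \<times>\<times> Z4))"
proof -
  \<comment> \<open>The orders are 1, 2, 4, 4 and 8, so counting settles every pair except
    \<open>Z2 \<times>\<times> Z2\<close> and \<open>Z4\<close>.\<close>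
  have neq: "\<not> trivial_gp \<cong> Z2" "\<not> trivial_gp \<cong> Z2 \<times>\<times> Z2" "\<not> trivial_gp \<cong> Z4"
    "\<not> trivial_gp \<cong> Z2 \<times>\<times> Z4" "\<not> Z2 \<cong> Z2 \<times>\<times> Z2" "\<not> Z2 \<cong> Z4" "\<not> Z2 \<cong> Z2 \<times>\<times> Z4"
    "\<not> Z2 \<times>\<times> Z2 \<cong> Z2 \<times>\<times> Z4" "\<not> Z4 \<cong> Z2 \<times>\<times> Z4"
    by (rule not_cong_if_card_neq, simp add: carrier_integer_mod_group card_cartesian_product)+
  have BIRM22_ex: "\<exists>G \<in> BIRM22 TYPE('q). G \<cong> trivial_gp" "\<exists>G \<in> BIRM22 TYPE('q). G \<cong> Z2"
    "\<exists>G \<in> BIRM22 TYPE('q). G \<cong> Z2 \<times>\<times> Z2"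
    using BIRM22_trivial BIRM22_Z2 BIRM22_Z2_Z2 assms by blast+
  then have BIR22_ex: "\<exists>G \<in> BIR22 TYPE('q). G \<cong> trivial_gp" "\<exists>G \<in> BIR22 TYPE('q). G \<cong> Z2"
    "\<exists>G \<in> BIR22 TYPE('q). G \<cong> Z2 \<times>\<times> Z2"
    using BIRM22_subset_BIR22 by blast+
  have not_ex: "\<not> (\<exists>G \<in> BIRM22 TYPE('q). G \<cong> Z4)" "\<not> (\<exists>G \<in> BIRM22 TYPE('q). G \<cong> Z2 \<times>\<times> Z4)"
    using BIRM22_not_cong[OF _ neq(3,6) Z2_Z2_not_cong_Z4] BIRM22_not_cong[OF _ neq(4,7,8)] by blast+
  show ?thesis
    by (intro conjI ballI not_ex neq Z2_Z2_not_cong_Z4 BIRM22_ex BIR22_ex BIRM22_subset_BIR22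
        BIR22_Z4 BIR22_Z2_Z4 assms; erule BIR22_cases BIRM22_cases)
qed

end
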